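(* The graph $G_{n,r}$ is gap-free when $r=1$ and $n\ge 5$, and also when $r=2$ and $n\ge 9$.
   Context: For integers $n,r$ with $0\le r\le \lfloor n/2\rfloor-1$, $G_{n,r}$ is the finite simple graph with vertex set $\{x_1,\ldots,x_n\}$ (in cyclic order, indices read modulo $n$) in which each $x_i$ is adjacent to every vertex other than $x_i$ itself and the vertices of $A_i=\{x_{i-r},\ldots,x_{i-1},x_{i+1},\ldots,x_{i+r}\}$. Equivalently, for $i<j$, $x_ix_j$ is an edge iff $r+1\le j-i\le n-(r+1)$. A graph is gap-free if for any two edges $\{u,v\}$ and $\{w,z\}$ with no common vertex, at least one of $\{u,w\},\{u,z\},\{v,w\},\{v,z\}$ is an edge. *)

theory Defs
  imports "Graph_Theory.Pair_Digraph" "HOL-Number_Theory.Cong"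
begin

text \<open>
  Finite simple graphs are rendered as \<^locale>\<open>pair_graph\<close>: finite, loop-free, symmetric
  digraphs without parallel arcs. The edge \<open>{u, v}\<close> is the pair of arcs \<open>(u, v)\<close>, \<open>(v, u)\<close>, so
  \<open>u \<rightarrow>\<^bsub>G\<^esub> v\<close> reads ``\<open>{u, v}\<close> is an edge of \<open>G\<close>''. The definition of \<open>gap_free\<close> is
  meant for such \<open>G\<close> only.
\<close>

definition gap_free :: "'a pair_pre_digraph \<Rightarrow> bool" where
  "gap_free G \<longleftrightarrow>
    (\<forall>u v w z. u \<rightarrow>\<^bsub>G\<^esub> v \<and> w \<rightarrow>\<^bsub>G\<^esub> z \<and> {u, v} \<inter> {w, z} = {} \<longrightarrow>
      u \<rightarrow>\<^bsub>G\<^esub> w \<or> u \<rightarrow>\<^bsub>G\<^esub> z \<or> v \<rightarrow>\<^bsub>G\<^esub> w \<or> v \<rightarrow>\<^bsub>G\<^esub> z)"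

text \<open>
  The vertex \<open>x\<^sub>i\<close> is represented by its index \<open>i \<in> {1..n}\<close>; \<open>cyc_nbrs n r i\<close> is the set
  \<open>A\<^sub>i = {x\<^bsub>i-r\<^esub>, \<dots>, x\<^bsub>i-1\<^esub>, x\<^bsub>i+1\<^esub>, \<dots>, x\<^bsub>i+r\<^esub>}\<close>. The congruences are over the integers
  because \<open>i - k\<close> may be negative.
\<close>

definition cyc_nbrs :: "nat \<Rightarrow> nat \<Rightarrow> nat \<Rightarrow> nat set" where
  "cyc_nbrs n r i =
    {j \<in> {1..n}. \<exists>k\<in>{1..r}. [int j = int i - int k] (mod int n) \<or> [int j = int i + int k] (mod int n)}"

definition G_graph :: "nat \<Rightarrow> nat \<Rightarrow> nat pair_pre_digraph" where
  "G_graph n r =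
    \<lparr> pverts = {1..n},
      parcs = {(i, j). i \<in> {1..n} \<and> j \<in> {1..n} \<and> j \<noteq> i \<and> j \<notin> cyc_nbrs n r i} \<rparr>"

lemma cyc_nbrs_sym:
  assumes "i \<in> {1..n}" "j \<in> cyc_nbrs n r i"
  shows "i \<in> cyc_nbrs n r j"
proof -
  from assms(2) obtain k where k: "k \<in> {1..r}"
    "[int j = int i - int k] (mod int n) \<or> [int j = int i + int k] (mod int n)"
    by (auto simp: cyc_nbrs_def)
  have "[int i = int j + int k] (mod int n) \<or> [int i = int j - int k] (mod int n)"
    using k(2) by (auto simp: cong_iff_dvd_diff algebra_simps dvd_diff_commute)
  then show ?thesis
    using assms(1) k(1) by (auto simp: cyc_nbrs_def)
qed

lemma pair_graph_G_graph: "pair_graph (G_graph n r)"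
proof
  show "finite (parcs (G_graph n r))"
    by (rule finite_subset[of _ "{1..n} \<times> {1..n}"]) (auto simp: G_graph_def)
  show "symmetric (G_graph n r)"
    unfolding symmetric_def using cyc_nbrs_sym[of _ n _ r]
    by (intro symI) (fastforce simp: G_graph_def)
qed (auto simp: G_graph_def)

lemma G_graph_edge_iff:
  assumes "2 * r + 2 \<le> n" "1 \<le> i" "i < j" "j \<le> n"
  shows "i \<rightarrow>\<^bsub>G_graph n r\<^esub> j \<longleftrightarrow> r + 1 \<le> j - i \<and> j - i \<le> n - (r + 1)"
proof -
  have dvd_iff: "int n dvd x \<longleftrightarrow> x = 0 \<or> x = int n" if "- int n < x" "x < 2 * int n" for x
  proof
    assume "int n dvd x"
    then obtain q where q: "x = int n * q" ..
    have n: "int n > 0" using assms by simp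
    have "int n * (-1) < int n * q" "int n * q < int n * 2" using that q by (simp_all add: mult.commute)
    then have "-1 < q" "q < 2"
      using n mult_less_cancel_left_pos by blast+
    then have "q = 0 \<or> q = 1" by auto
    then show "x = 0 \<or> x = int n" using q by auto
  qed auto
  have "j \<in> cyc_nbrs n r i \<longleftrightarrow>
      (\<exists>k\<in>{1..r}. int n dvd int j - int i + int k \<or> int n dvd int j - int i - int k)"
    using assms by (auto simp: cyc_nbrs_def cong_iff_dvd_diff algebra_simps)
  also have "\<dots> \<longleftrightarrow> (\<exists>k\<in>{1..r}. j - i = n - k \<or> j - i = k)"
  proof (rule bex_cong[OF refl])
    fix k assume k: "k \<in> {1..r}"
    have "int n dvd int j - int i + int k \<longleftrightarrow> j - i = n - k"
      using assms k by (subst dvd_iff) auto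
    moreover have "int n dvd int j - int i - int k \<longleftrightarrow> j - i = k"
      using assms k by (subst dvd_iff) auto
    ultimately show "(int n dvd int j - int i + int k \<or> int n dvd int j - int i - int k)
        \<longleftrightarrow> (j - i = n - k \<or> j - i = k)" by simp
  qed
  also have "\<dots> \<longleftrightarrow> \<not> (r + 1 \<le> j - i \<and> j - i \<le> n - (r + 1))"
  proof
    assume "\<not> (r + 1 \<le> j - i \<and> j - i \<le> n - (r + 1))"
    then consider "j - i \<in> {1..r}" | "n - (j - i) \<in> {1..r}"
      using assms by fastforce
    then show "\<exists>k\<in>{1..r}. j - i = n - k \<or> j - i = k"
    proof cases
      case 1
      then show ?thesis by blast
    next
      case 2
      moreover have "j - i = n - (n - (j - i))" using assms by simp
      ultimately show ?thesis by blast
    qed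
  qed (use assms in auto)
  finally show ?thesis
    using assms by (auto simp: G_graph_def)
qed

end

theory Submission
  imports Defs
begin

text \<open>
  Two indices are nonadjacent (or equal) iff they differ by a step of size at most \<open>r\<close> modulo \<open>n\<close>.
  A gap thus gives a closed walk \<open>u, w, v, z, u\<close> with four such steps; as \<open>4 * r < n\<close>, the steps sum
  to \<open>0\<close>, so the walk lifts to the integers. There, two integers more than \<open>r\<close> apart cannot both
  be within \<open>r\<close> of each of two integers that are themselves more than \<open>r\<close> apart.
\<close>

text \<open>A signed step \<open>k\<close> merges the two congruences of \<open>cyc_nbrs\<close>,
  and \<open>k = 0\<close> accounts for \<open>j = i\<close>. The result needs no case split on the
  order of \<open>i\<close> and \<open>j\<close>, so steps can be added and subtracted
  freely.\<close>

lemma G_graph_edge_iff_cong: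
  "i \<rightarrow>\<^bsub>G_graph n r\<^esub> j \<longleftrightarrow>
    i \<in> {1..n} \<and> j \<in> {1..n} \<and> (\<forall>k. \<bar>k\<bar> \<le> int r \<longrightarrow> \<not> [int j = int i + k] (mod int n))"
proof (cases "i \<in> {1..n} \<and> j \<in> {1..n}")
  case True
  have zero: "[int j = int i] (mod int n) \<longleftrightarrow> j = i"
  proof
    assume "[int j = int i] (mod int n)"
    \<comment> \<open>Shifting \<open>{1..n}\<close> down to the residues
      \<open>0, ..., n - 1\<close> turns congruence into equality.\<close>
    then have "[int (j - 1) = int (i - 1)] (mod int n)"
      using True by (simp add: cong_iff_dvd_diff of_nat_diff)
    then show "j = i"
      using True by (subst (asm) cong_int_iff) (auto simp: cong_def)
  qed simp
  have "(\<exists>k. \<bar>k\<bar> \<le> int r \<and> [int j = int i + k] (mod int n)) \<longleftrightarrow> j = i \<or> j \<in> cyc_nbrs n r i"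
  proof
    assume "\<exists>k. \<bar>k\<bar> \<le> int r \<and> [int j = int i + k] (mod int n)"
    then obtain k where k: "\<bar>k\<bar> \<le> int r" "[int j = int i + k] (mod int n)" by blast
    consider "k = 0" | "k > 0" | "k < 0" by linarith
    then show "j = i \<or> j \<in> cyc_nbrs n r i"
    proof cases
      case 1
      then show ?thesis using k zero by simp
    next
      case 2
      then show ?thesis
        using k True by (auto simp: cyc_nbrs_def intro!: bexI[of _ "nat k"])
    next
      case 3
      then show ?thesis
        using k True by (auto simp: cyc_nbrs_def intro!: bexI[of _ "nat (- k)"])
    qed
  next
    assume "j = i \<or> j \<in> cyc_nbrs n r i"
    then consider "j = i"
      | k where "k \<in> {1..r}" "[int j = int i - int k] (mod int n)"
      | k where "k \<in> {1..r}" "[int j = int i + int k] (mod int n)"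
      by (auto simp: cyc_nbrs_def)
    then show "\<exists>k. \<bar>k\<bar> \<le> int r \<and> [int j = int i + k] (mod int n)"
    proof cases
      case 1
      then show ?thesis by (intro exI[of _ 0]) simp
    next
      case (2 k)
      then show ?thesis by (intro exI[of _ "- int k"]) simp
    next
      case (3 k)
      then show ?thesis by (intro exI[of _ "int k"]) simp
    qed
  qed
  then show ?thesis using True by (auto simp: G_graph_def)
qed (auto simp: G_graph_def)

lemma gap_free_G_graph:
  assumes "4 * r < n"
  shows "gap_free (G_graph n r)"
  unfolding gap_free_def
proof (intro allI impI, rule ccontr)
  fix u v w z
  assume "u \<rightarrow>\<^bsub>G_graph n r\<^esub> v \<and> w \<rightarrow>\<^bsub>G_graph n r\<^esub> z \<and> {u, v} \<inter> {w, z} = {}"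
  then have uv: "u \<rightarrow>\<^bsub>G_graph n r\<^esub> v" and wz: "w \<rightarrow>\<^bsub>G_graph n r\<^esub> z" by auto
  assume no_edge: "\<not> (u \<rightarrow>\<^bsub>G_graph n r\<^esub> w \<or> u \<rightarrow>\<^bsub>G_graph n r\<^esub> z \<or>
    v \<rightarrow>\<^bsub>G_graph n r\<^esub> w \<or> v \<rightarrow>\<^bsub>G_graph n r\<^esub> z)"
  \<comment> \<open>\<open>uv\<close> and \<open>wz\<close> put all four endpoints in
    \<open>{1..n}\<close>, so a missing edge can only come from a short step.\<close>
  have step: "\<exists>k. \<bar>k\<bar> \<le> int r \<and> int n dvd int y - int x - k"
    if "\<not> x \<rightarrow>\<^bsub>G_graph n r\<^esub> y" "x \<in> {u, v}" "y \<in> {w, z}" for x y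
    using that uv wz unfolding G_graph_edge_iff_cong cong_iff_dvd_diff diff_diff_eq by auto
  obtain a where a: "\<bar>a\<bar> \<le> int r" "int n dvd int w - int u - a"
    using step[of u w] no_edge by auto
  obtain b where b: "\<bar>b\<bar> \<le> int r" "int n dvd int w - int v - b"
    using step[of v w] no_edge by auto
  obtain c where c: "\<bar>c\<bar> \<le> int r" "int n dvd int z - int v - c"
    using step[of v z] no_edge by auto
  obtain d where d: "\<bar>d\<bar> \<le> int r" "int n dvd int z - int u - d"
    using step[of u z] no_edge by auto
  have far: "\<bar>k\<bar> > int r"
    if "x \<rightarrow>\<^bsub>G_graph n r\<^esub> y" "int n dvd int y - int x - k" for x y k
    using that(1)[unfolded G_graph_edge_iff_cong cong_iff_dvd_diff] that(2)
    unfolding diff_diff_eq by (meson linorder_not_le)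
  \<comment> \<open>Here \<open>w\<close> cancels: \<open>a - b\<close> represents
    \<open>v - u\<close> modulo \<open>n\<close>. Likewise \<open>c - b\<close> below represents
    \<open>z - w\<close>.\<close>
  have "int n dvd (int w - int u - a) - (int w - int v - b)"
    using a(2) b(2) by (rule dvd_diff)
  then have ab: "\<bar>a - b\<bar> > int r"
    by (intro far[OF uv]) (simp add: algebra_simps)
  have "int n dvd (int z - int v - c) - (int w - int v - b)"
    using c(2) b(2) by (rule dvd_diff)
  then have cb: "\<bar>c - b\<bar> > int r"
    by (intro far[OF wz]) (simp add: algebra_simps)
  have "int n dvd ((int z - int v - c) - (int w - int v - b)) -
      ((int z - int u - d) - (int w - int u - a))"
    using dvd_diff[OF dvd_diff[OF c(2) b(2)] dvd_diff[OF d(2) a(2)]] .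
  then have "int n dvd d - a + b - c" by (simp add: algebra_simps)
  \<comment> \<open>Four terms of size at most \<open>r\<close> sum to at most
    \<open>4 * r < n\<close>, so the only possible multiple of \<open>n\<close> is
    \<open>0\<close>.\<close>
  moreover have "\<bar>d - a + b - c\<bar> < int n" using a b c d assms by linarith
  ultimately have "d - a + b - c = 0" using dvd_imp_le_int[of "d - a + b - c" "int n"] by linarith
  \<comment> \<open>If \<open>a - b\<close> and \<open>c - b\<close> have the same sign, their sum
    \<open>d - b\<close> exceeds \<open>2 * r\<close> in size; otherwise their difference
    \<open>a - c\<close> does. Both contradict the bounds by \<open>r\<close>.\<close>
  then show False using a(1) b(1) c(1) d(1) ab cb by linarith
qed

theorem lemma3p9:
  fixes n r :: nat
  assumes "r = 1 \<and> n \<ge> 5 \<or> r = 2 \<and> n \<ge> 9"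
  shows "gap_free (G_graph n r)"
  using assms by (intro gap_free_G_graph) auto

end
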